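(* Let $n$ be even. Then $P_{n,n^2}(\det_n)$ is the difference between the number of even and the number of odd admissible $n$-tables. Moreover, $P_{n,n^2}(\mathrm{per}_n)$ is the difference between the number of column-even and the number of column-odd admissible $n$-tables.
   Context: Notation: $[k]=\{1,\dots,k\}$. The invariant: for $m\ge1$, $D$ even and $v=\sum v(\nu_1,\dots,\nu_D)\,e_{\nu_1}\otimes\cdots\otimes e_{\nu_D}\in\bigotimes^D\mathbb{C}^m$, $$P_{D,m}(v)=\sum_{\sigma_1,\dots,\sigma_D\in S_m}\Big[\prod_{j=1}^D\mathrm{sgn}(\sigma_j)\Big]\prod_{i=1}^m v(\sigma_1(i),\dots,\sigma_D(i)).$$ A form of degree $D$ in $m$ variables is evaluated via its symmetric tensor, where $X_{i_1}\cdots X_{i_D}$ corresponds to $\frac1{D!}\sum_{\pi\in S_D}e_{i_{\pi(1)}}\otimes\cdots\otimes e_{i_{\pi(D)}}$. Here $D=n$, $m=n^2$, the basis of $\mathbb{C}^{n\times n}=\mathbb{C}^{n^2}$ is indexed by $[n]\times[n]$, identified with $[n^2]$ via a fixed ordering; $\det_n=\sum_{\pi\in S_n}\mathrm{sgn}(\pi)X_{\pi(1),1}\cdots X_{\pi(n),n}$ and $\mathrm{per}_n=\sum_{\pi\in S_n}X_{\pi(1),1}\cdots X_{\pi(n),n}$ in $\mathrm{Sym}^n\mathbb{C}^{n\times n}$. Tables: consider maps $S\colon[n^2]\times[n]\to[n]$, viewed as $n^2\times n$ matrices, such that each row $S(i,\cdot)$ is a permutation of $[n]$; the row-sign of $S$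 is the product of the signs of its rows. A pair $(S,T)$ of such maps is an admissible $n$-table if for every $j\in[n]$ the map $[n^2]\to[n]\times[n]$, $i\mapsto(S(i,j),T(i,j))$ is bijective. After fixing an ordering of $[n]\times[n]$ each of these bijections has a sign; the column-sign of $(S,T)$ is the product over $j\in[n]$ of these signs. The table is column-even if its column-sign is $1$ and column-odd otherwise. The row-sign of $(S,T)$ is the product of the row-signs of $S$ and $T$. The sign of $(S,T)$ is the product of its row-sign and its column-sign; the table is even if its sign is $1$ and odd otherwise.
   Formalization: With the symmetric tensor normalised by 1/D!, both equalities need the factor 1/(n!)^(n^2) on the difference of the table counts; without it they fail already for n = 2, where the invariant is 3/2 and the difference is 24. *)

theory Defs
  imports
    Complex_Main
    "HOL-Library.FuncSet"
    "HOL-Library.Poly_Mapping"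
    "HOL-Combinatorics.Permutations"
begin

text \<open>
  Polynomials over the complex numbers in variables indexed by \<open>nat\<close>: finitely supported
  coefficient functions on monomials (finitely supported exponent vectors), with the
  convolution product of \<^theory>\<open>HOL-Library.Poly_Mapping\<close>.
\<close>

type_synonym mpoly_complex = "(nat \<Rightarrow>\<^sub>0 nat) \<Rightarrow>\<^sub>0 complex"

definition var :: "nat \<Rightarrow> mpoly_complex" where
  "var x = Poly_Mapping.single (Poly_Mapping.single x 1) 1"

text \<open>
  The space of tensors of order \<open>D\<close> over the \<open>m\<close>-dimensional complex space is represented by
  coefficient functions on multi-indices \<open>\<nu>\<close>, a multi-index being a function
  \<open>{1..D} \<rightarrow> {1..m}\<close>; only the values of \<open>\<nu>\<close> on \<open>{1..D}\<close> matter.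
\<close>

type_synonym tensor = "(nat \<Rightarrow> nat) \<Rightarrow> complex"

definition basis_tensor :: "nat \<Rightarrow> (nat \<Rightarrow> nat) \<Rightarrow> tensor" where
  "basis_tensor D i \<nu> = (if \<forall>k\<in>{1..D}. \<nu> k = i k then 1 else 0)"

text \<open>
  For a monomial \<open>\<alpha>\<close> of degree \<open>D\<close>, some indices with \<open>\<alpha> = X_(i 1) ... X_(i D)\<close>. They are unique
  only up to reordering, which does not affect the symmetric tensor; see
  \<open>sym_tensor_monomial\<close> below. The value is unspecified for monomials of other degrees.
\<close>

definition monomial_word :: "nat \<Rightarrow> (nat \<Rightarrow>\<^sub>0 nat) \<Rightarrow> (nat \<Rightarrow> nat)" where
  "monomial_word D \<alpha> = (SOME i. (\<Prod>k=1..D. var (i k)) = Poly_Mapping.single \<alpha> 1)"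

text \<open>
  The symmetric tensor of a form \<open>f\<close> of degree \<open>D\<close>: the linear extension of the assignment
  \<open>X_(i 1) ... X_(i D) \<mapsto> 1/D! \<Sum>\<pi>. e_(i (\<pi> 1)) \<otimes> ... \<otimes> e_(i (\<pi> D))\<close>.
\<close>

definition sym_tensor :: "nat \<Rightarrow> mpoly_complex \<Rightarrow> tensor" where
  "sym_tensor D f \<nu> = (\<Sum>\<alpha>\<in>Poly_Mapping.keys f. Poly_Mapping.lookup f \<alpha> *
     ((1 / fact D) * (\<Sum>\<pi> | \<pi> permutes {1..D}. basis_tensor D (monomial_word D \<alpha> \<circ> \<pi>) \<nu>)))"

definition P_invariant :: "nat \<Rightarrow> nat \<Rightarrow> tensor \<Rightarrow> complex" where
  "P_invariant D m v =
     (\<Sum>\<sigma>\<in>(\<Pi>\<^sub>E j\<in>{1..D}. {p. p permutes {1..m}}).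
        of_int (\<Prod>j=1..D. sign (\<sigma> j)) * (\<Prod>i=1..m. v (\<lambda>j\<in>{1..D}. \<sigma> j i)))"

text \<open>
  The map \<open>b\<close> is an ordering of the matrix positions, i.e. a bijection
  \<open>{1..n} \<times> {1..n} \<rightarrow> {1..n^2}\<close>; the matrix entry at position \<open>(i, j)\<close> is the variable
  with number \<open>b (i, j)\<close>.
\<close>

definition det_form :: "nat \<Rightarrow> (nat \<times> nat \<Rightarrow> nat) \<Rightarrow> mpoly_complex" where
  "det_form n b = (\<Sum>\<pi> | \<pi> permutes {1..n}. of_int (sign \<pi>) * (\<Prod>j=1..n. var (b (\<pi> j, j))))"

definition per_form :: "nat \<Rightarrow> (nat \<times> nat \<Rightarrow> nat) \<Rightarrow> mpoly_complex" where
  "per_form n b = (\<Sum>\<pi> | \<pi> permutes {1..n}. (\<Prod>j=1..n. var (b (\<pi> j, j))))"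

text \<open>
  Tables are extensional functions on \<open>{1..n^2} \<times> {1..n}\<close>, so that they form a finite set and can
  be counted. The library function \<^const>\<open>sign\<close> expects a permutation of the whole type; a
  bijection of \<open>{1..k}\<close> to itself is extended by the identity with \<^const>\<open>restrict_id\<close>.
\<close>

type_synonym table = "nat \<times> nat \<Rightarrow> nat"

definition row_perm_tables :: "nat \<Rightarrow> table set" where
  "row_perm_tables n = {S \<in> {1..n^2} \<times> {1..n} \<rightarrow>\<^sub>E {1..n}.
     \<forall>i\<in>{1..n^2}. bij_betw (\<lambda>j. S (i, j)) {1..n} {1..n}}"

definition admissible_tables :: "nat \<Rightarrow> (table \<times> table) set" where
  "admissible_tables n = {(S, T). S \<in> row_perm_tables n \<and> T \<in> row_perm_tables n \<and>
     (\<forall>j\<in>{1..n}. bij_betw (\<lambda>i. (S (i, j), T (i, j))) {1..n^2} ({1..n} \<times> {1..n}))}"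

definition row_sign1 :: "nat \<Rightarrow> table \<Rightarrow> int" where
  "row_sign1 n S = (\<Prod>i=1..n^2. sign (restrict_id (\<lambda>j. S (i, j)) {1..n}))"

definition row_sign :: "nat \<Rightarrow> table \<times> table \<Rightarrow> int" where
  "row_sign n = (\<lambda>(S, T). row_sign1 n S * row_sign1 n T)"

definition column_sign :: "nat \<Rightarrow> (nat \<times> nat \<Rightarrow> nat) \<Rightarrow> table \<times> table \<Rightarrow> int" where
  "column_sign n b = (\<lambda>(S, T).
     \<Prod>j=1..n. sign (restrict_id (\<lambda>i. b (S (i, j), T (i, j))) {1..n^2}))"

definition table_sign :: "nat \<Rightarrow> (nat \<times> nat \<Rightarrow> nat) \<Rightarrow> table \<times> table \<Rightarrow> int" where
  "table_sign n b ST = row_sign n ST * column_sign n b ST"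

definition even_tables :: "nat \<Rightarrow> (nat \<times> nat \<Rightarrow> nat) \<Rightarrow> (table \<times> table) set" where
  "even_tables n b = {ST \<in> admissible_tables n. table_sign n b ST = 1}"

definition odd_tables :: "nat \<Rightarrow> (nat \<times> nat \<Rightarrow> nat) \<Rightarrow> (table \<times> table) set" where
  "odd_tables n b = {ST \<in> admissible_tables n. table_sign n b ST \<noteq> 1}"

definition column_even_tables :: "nat \<Rightarrow> (nat \<times> nat \<Rightarrow> nat) \<Rightarrow> (table \<times> table) set" where
  "column_even_tables n b = {ST \<in> admissible_tables n. column_sign n b ST = 1}"

definition column_odd_tables :: "nat \<Rightarrow> (nat \<times> nat \<Rightarrow> nat) \<Rightarrow> (table \<times> table) set" where
  "column_odd_tables n b = {ST \<in> admissible_tables n. column_sign n b ST \<noteq> 1}"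

lemma prod_var:
  "finite A \<Longrightarrow> (\<Prod>k\<in>A. var (i k)) = Poly_Mapping.single (\<Sum>k\<in>A. Poly_Mapping.single (i k) 1) 1"
  by (induction A rule: finite_induct) (auto simp: var_def mult_single)

text \<open>
  In particular, if the \<open>i k\<close> are distinct, the nonzero coefficients of this tensor are all equal
  to \<open>1/D!\<close>. The monomials of \<^const>\<open>det_form\<close> and \<^const>\<open>per_form\<close> are of this kind, which
  is why evaluating the invariant, homogeneous of degree \<open>n^2\<close>, on them produces the factor
  \<open>1/(n!)^(n^2)\<close>.
\<close>

lemma sym_tensor_monomial:
  "sym_tensor D (\<Prod>k=1..D. var (i k)) \<nu> =
     (1 / fact D) * (\<Sum>\<pi> | \<pi> permutes {1..D}. basis_tensor D (i \<circ> \<pi>) \<nu>)"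
proof -
  define \<alpha> where "\<alpha> = (\<Sum>k=1..D. Poly_Mapping.single (i k) (1::nat))"
  have prod: "(\<Prod>k=1..D. var (i k)) = Poly_Mapping.single \<alpha> 1"
    by (simp add: prod_var \<alpha>_def)
  define w where "w = monomial_word D \<alpha>"
  have "(\<Prod>k=1..D. var (w k)) = Poly_Mapping.single \<alpha> 1"
    unfolding w_def monomial_word_def by (rule someI[of _ i]) (rule prod)
  then have "(\<Sum>k=1..D. Poly_Mapping.single (w k) (1::nat)) = \<alpha>"
    by (simp add: prod_var) (metis keys_single singleton_inject zero_neq_one)
  then have eq: "(\<Sum>k=1..D. Poly_Mapping.single (w k) (1::nat)) =
      (\<Sum>k=1..D. Poly_Mapping.single (i k) 1)"
    by (simp add: \<alpha>_def)
  have cnt: "Poly_Mapping.lookup (\<Sum>k=1..D. Poly_Mapping.single (u k) (1::nat)) x =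
      count (image_mset u (mset_set {1..D})) x" for u :: "nat \<Rightarrow> nat" and x
  proof -
    have "Poly_Mapping.lookup (\<Sum>k\<in>A. Poly_Mapping.single (u k) (1::nat)) x =
        count (image_mset u (mset_set A)) x" if "finite A" for A
      using that by (induction A rule: finite_induct) (auto simp: lookup_add lookup_single when_def)
    then show ?thesis by simp
  qed
  have "image_mset i (mset_set {1..D}) = image_mset w (mset_set {1..D})"
    by (rule multiset_eqI) (metis cnt eq)
  then obtain \<rho> where \<rho>: "\<rho> permutes {1..D}" and "\<forall>k\<in>{1..D}. i k = w (\<rho> k)"
    using image_mset_eq_implies_permutes[of "{1..D}" i w] by auto
  then have iw: "i k = w (\<rho> k)" if "k \<in> {1..D}" for k using that by blast
  have "(\<Sum>\<pi> | \<pi> permutes {1..D}. basis_tensor D (w \<circ> \<pi>) \<nu>) =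
      (\<Sum>\<pi> | \<pi> permutes {1..D}. basis_tensor D (w \<circ> (\<rho> \<circ> \<pi>)) \<nu>)"
    by (rule setum_permutations_compose_left[OF \<rho>])
  also have "\<dots> = (\<Sum>\<pi> | \<pi> permutes {1..D}. basis_tensor D (i \<circ> \<pi>) \<nu>)"
  proof (rule sum.cong[OF refl])
    fix \<pi> assume "\<pi> \<in> {\<pi>. \<pi> permutes {1..D}}"
    then have "\<pi> k \<in> {1..D}" if "k \<in> {1..D}" for k
      using that permutes_in_image[of \<pi> "{1..D}" k] by simp
    then show "basis_tensor D (w \<circ> (\<rho> \<circ> \<pi>)) \<nu> = basis_tensor D (i \<circ> \<pi>) \<nu>"
      using iw unfolding basis_tensor_def by simp
  qed
  finally show ?thesis
    unfolding sym_tensor_def prod by (simp add: w_def)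
qed

end

theory Submission
  imports Defs
begin

text \<open>
  The invariant is a signed sum over \<open>n\<close>-tuples \<open>(\<sigma> 1, ..., \<sigma> n)\<close> of permutations of the matrix
  positions. Decode the position \<open>\<sigma> j i\<close> as a pair \<open>(S (i, j), T (i, j))\<close>: row \<open>i\<close> of the two
  arrays lists the index at which the \<open>i\<close>-th factor reads the tensor, and column \<open>j\<close> is the
  permutation \<open>\<sigma> j\<close>. So arrays with bijective columns are the same thing as the tuples that are
  summed over, and the product of the signs of the \<open>\<sigma> j\<close> is the column sign.

  The other condition on a table comes from the form. A monomial
  \<open>X_(\<pi> 1, 1) ... X_(\<pi> n, n)\<close> has \<open>n\<close> distinct factors, and they can be listed in \<open>n!\<close> orders. Listed
  in the order \<open>\<rho>\<close>, their second indices form the permutation \<open>\<rho>\<close> and their first indices the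
  permutation \<open>\<pi> \<circ> \<rho>\<close>. Conversely, two permutations \<open>s\<close> and \<open>t\<close> arise from exactly one such pair,
  namely \<open>\<rho> = t\<close> and \<open>\<pi> = s \<circ> t\<inverse>\<close>. So the coordinate of the symmetric tensor at a row \<open>(s, t)\<close>
  vanishes unless both \<open>s\<close> and \<open>t\<close> are permutations, and then it is \<open>1 / n!\<close> times the coefficient
  of \<open>s \<circ> t\<inverse>\<close> (\<open>sym_tensor_immanant\<close>). For the determinant that coefficient is
  \<open>sgn s * sgn t\<close>, for the permanent it is \<open>1\<close>. Multiplying over the \<open>n^2\<close> rows leaves a sum over the
  admissible tables, with the constant \<open>(1 / n!)^(n^2)\<close> in front; its terms are the table signs
  or the column signs (\<open>P_invariant_table_sum\<close>).

  The form and the counts may use different orderings of the positions. Changing the ordering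
  multiplies the sign of every column by the sign of one fixed permutation, and as there are
  \<open>n\<close> columns and \<open>n\<close> is even, the column sign does not change
  (\<open>column_sign_ordering_independent\<close>). Finally a sum of signs counts the terms \<open>1\<close> minus the others.
\<close>

(* Otherwise the simplifier turns {1..n} into {Suc 0..n}, and facts about {1..n} no longer match. *)
declare One_nat_def [simp del]

section \<open>Linearity of the symmetric tensor\<close>

lemma sym_tensor_zero [simp]: "sym_tensor D 0 \<nu> = 0"
  by (simp add: sym_tensor_def)

lemma sym_tensor_add: "sym_tensor D (f + g) \<nu> = sym_tensor D f \<nu> + sym_tensor D g \<nu>"
  unfolding sym_tensor_def
  by (rule setsum_keys_plus_distrib) (simp_all add: distrib_right add_divide_distrib)

lemma sym_tensor_minus: "sym_tensor D (- f) \<nu> = - sym_tensor D f \<nu>"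
  using sym_tensor_add[of D f "- f" \<nu>] by (simp add: add_eq_0_iff)

lemma sym_tensor_sum: "sym_tensor D (\<Sum>x\<in>A. f x) \<nu> = (\<Sum>x\<in>A. sym_tensor D (f x) \<nu>)"
  by (induction A rule: infinite_finite_induct) (auto simp: sym_tensor_add)

text \<open>This follows from additivity alone, because the scalar is an integer.\<close>

lemma sym_tensor_of_int_mult:
  "sym_tensor D (of_int k * f) \<nu> = of_int k * sym_tensor D f \<nu>"
proof (induction k rule: int_induct[where k = 0])
  case base
  show ?case by simp
next
  case (step1 k)
  then show ?case by (simp add: distrib_right sym_tensor_add)
next
  case (step2 k)
  have "sym_tensor D (of_int (k - 1) * f) \<nu> = sym_tensor D (of_int k * f + - f) \<nu>"
    by (simp add: left_diff_distrib)
  with step2 show ?case by (simp only: sym_tensor_add sym_tensor_minus) (simp add: left_diff_distrib)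
qed

section \<open>Coordinates of the symmetric tensor of an immanant\<close>

lemma permutes_eq_restrict_id:
  assumes "p permutes A" "\<And>x. x \<in> A \<Longrightarrow> f x = p x"
  shows "p = restrict_id f A"
  using assms by (auto simp: fun_eq_iff restrict_id_def permutes_def)

text \<open>
  The determinant and the permanent are the cases \<open>w = sign\<close> and \<open>w = 1\<close> of a form with arbitrary
  coefficients \<open>w \<pi>\<close>. The coordinate is a double sum over \<open>\<pi>\<close> and the order \<open>\<rho>\<close> of the factors; at
  most the one pair with \<open>\<pi> \<circ> \<rho> = s\<close> and \<open>\<rho> = t\<close> contributes. The permutations \<open>s\<close> and \<open>t\<close> are only
  given on \<open>{1..n}\<close>, hence \<^const>\<open>restrict_id\<close>.
\<close>

lemma sym_tensor_immanant:
  fixes w :: "(nat \<Rightarrow> nat) \<Rightarrow> int"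
  assumes b: "inj_on b ({1..n} \<times> {1..n})"
    and s: "s \<in> {1..n} \<rightarrow> {1..n}" and t: "t \<in> {1..n} \<rightarrow> {1..n}"
  shows "sym_tensor n (\<Sum>\<pi> | \<pi> permutes {1..n}. of_int (w \<pi>) * (\<Prod>j=1..n. var (b (\<pi> j, j))))
      (\<lambda>j\<in>{1..n}. b (s j, t j)) =
    1 / fact n * (if bij_betw s {1..n} {1..n} \<and> bij_betw t {1..n} {1..n}
      then of_int (w (restrict_id s {1..n} \<circ> inv (restrict_id t {1..n}))) else 0)"
    (is "?L = _ * ?R")
proof -
  let ?I = "{1..n}" and ?\<nu> = "\<lambda>j\<in>{1..n}. b (s j, t j)"
  let ?Q = "{p. p permutes ?I}"
  define \<rho>0 where "\<rho>0 = restrict_id t ?I"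
  define \<pi>0 where "\<pi>0 = restrict_id s ?I \<circ> inv \<rho>0"
  define bij where "bij \<longleftrightarrow> bij_betw s ?I ?I \<and> bij_betw t ?I ?I"
  (* The basis tensors compare positions; since b is injective, rows and columns must agree. *)
  have delta: "basis_tensor n ((\<lambda>k. b (\<pi> k, k)) \<circ> \<rho>) ?\<nu> =
      (if bij \<and> \<pi> = \<pi>0 \<and> \<rho> = \<rho>0 then 1 else 0)"
    if \<pi>: "\<pi> permutes ?I" and \<rho>: "\<rho> permutes ?I" for \<pi> \<rho>
  proof -
    have rk: "\<rho> k \<in> ?I" "\<pi> (\<rho> k) \<in> ?I" if "k \<in> ?I" for k
      using that permutes_in_image[OF \<pi>] permutes_in_image[OF \<rho>] by auto
    have "(\<forall>k\<in>?I. ?\<nu> k = ((\<lambda>k. b (\<pi> k, k)) \<circ> \<rho>) k) \<longleftrightarrow> (\<forall>k\<in>?I. s k = (\<pi> \<circ> \<rho>) k \<and> t k = \<rho> k)"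
      using rk s t by (intro ball_cong refl) (auto simp: inj_on_eq_iff[OF b] Pi_iff)
    also have "\<dots> \<longleftrightarrow> bij \<and> \<pi> = \<pi>0 \<and> \<rho> = \<rho>0"
    proof
      assume *: "\<forall>k\<in>?I. s k = (\<pi> \<circ> \<rho>) k \<and> t k = \<rho> k"
      have \<pi>\<rho>: "\<pi> \<circ> \<rho> permutes ?I"
        using permutes_compose[OF \<rho> \<pi>] .
      have "\<rho> = \<rho>0"
        unfolding \<rho>0_def using * by (intro permutes_eq_restrict_id[OF \<rho>]) auto
      moreover have "\<pi> \<circ> \<rho> = restrict_id s ?I"
        using * by (intro permutes_eq_restrict_id[OF \<pi>\<rho>]) auto
      then have "\<pi> = restrict_id s ?I \<circ> inv \<rho>"
        by (metis \<rho> comp_assoc comp_id permutes_inv_o(1))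
      moreover have "bij"
        unfolding bij_def
        using * permutes_imp_bij[OF \<pi>\<rho>] permutes_imp_bij[OF \<rho>]
          bij_betw_cong[of ?I s "\<pi> \<circ> \<rho>" ?I] bij_betw_cong[of ?I t \<rho> ?I] by blast
      ultimately show "bij \<and> \<pi> = \<pi>0 \<and> \<rho> = \<rho>0"
        by (simp add: \<pi>0_def)
    next
      assume *: "bij \<and> \<pi> = \<pi>0 \<and> \<rho> = \<rho>0"
      then have "\<pi> \<circ> \<rho> = restrict_id s ?I"
        unfolding \<pi>0_def by (metis \<rho> comp_assoc comp_id permutes_inv_o(2))
      with * show "\<forall>k\<in>?I. s k = (\<pi> \<circ> \<rho>) k \<and> t k = \<rho> k"
        by (simp add: \<rho>0_def)
    qed
    finally show ?thesis
      by (simp add: basis_tensor_def)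
  qed
  have "?L = (\<Sum>\<pi>\<in>?Q. of_int (w \<pi>) * (1 / fact n *
      (\<Sum>\<rho>\<in>?Q. basis_tensor n ((\<lambda>k. b (\<pi> k, k)) \<circ> \<rho>) ?\<nu>)))"
    by (simp only: sym_tensor_sum sym_tensor_of_int_mult sym_tensor_monomial)
  also have "\<dots> = 1 / fact n * (\<Sum>\<pi>\<in>?Q. \<Sum>\<rho>\<in>?Q.
      of_int (w \<pi>) * (if bij \<and> \<pi> = \<pi>0 \<and> \<rho> = \<rho>0 then 1 else 0))"
    unfolding sum_distrib_left by (intro sum.cong refl) (simp add: delta)
  also have "(\<Sum>\<pi>\<in>?Q. \<Sum>\<rho>\<in>?Q.
      of_int (w \<pi>) * (if bij \<and> \<pi> = \<pi>0 \<and> \<rho> = \<rho>0 then 1 else (0::complex))) = ?R"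
  proof (cases bij)
    case True
    then have mem: "\<rho>0 \<in> ?Q" "\<pi>0 \<in> ?Q"
      by (auto simp: bij_def \<rho>0_def \<pi>0_def
          intro!: permutes_compose permutes_inv permutes_restrict_id)
    have "(\<Sum>\<rho>\<in>?Q. of_int (w \<pi>) * (if bij \<and> \<pi> = \<pi>0 \<and> \<rho> = \<rho>0 then 1 else (0::complex))) =
        (if \<pi> = \<pi>0 then of_int (w \<pi>) else 0)" for \<pi>
      using True mem by (auto simp: finite_permutations if_distrib cong: if_cong)
    then show ?thesis
      using True mem by (simp add: finite_permutations bij_def \<pi>0_def \<rho>0_def)
  next
    case False
    then show ?thesis by (auto simp: bij_def)
  qed
  finally show ?thesis .
qed

section \<open>Tables and tuples of permutations\<close>

text \<open>
  The two directions of the correspondence between tables and the tuples over which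
  \<^const>\<open>P_invariant\<close> sums.
\<close>

definition column_perms ::
    "nat \<Rightarrow> (nat \<times> nat \<Rightarrow> nat) \<Rightarrow> table \<times> table \<Rightarrow> nat \<Rightarrow> nat \<Rightarrow> nat" where
  "column_perms n b = (\<lambda>(S, T). \<lambda>j\<in>{1..n}. restrict_id (\<lambda>i. b (S (i, j), T (i, j))) {1..n^2})"

definition position_tables ::
    "nat \<Rightarrow> (nat \<times> nat \<Rightarrow> nat) \<Rightarrow> (nat \<Rightarrow> nat \<Rightarrow> nat) \<Rightarrow> table \<times> table" where
  "position_tables n b \<sigma> =
     ((\<lambda>(i, j)\<in>{1..n^2} \<times> {1..n}. fst (inv_into ({1..n} \<times> {1..n}) b (\<sigma> j i))),
      (\<lambda>(i, j)\<in>{1..n^2} \<times> {1..n}. snd (inv_into ({1..n} \<times> {1..n}) b (\<sigma> j i))))"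

definition rows_bij :: "nat \<Rightarrow> table \<times> table \<Rightarrow> bool" where
  "rows_bij n = (\<lambda>(S, T). \<forall>i\<in>{1..n^2}.
     bij_betw (\<lambda>j. S (i, j)) {1..n} {1..n} \<and> bij_betw (\<lambda>j. T (i, j)) {1..n} {1..n})"

lemma position_tables_column_perms:
  assumes b: "bij_betw b ({1..n} \<times> {1..n}) {1..n^2}" and "ST \<in> admissible_tables n"
  shows "position_tables n b (column_perms n b ST) = ST"
proof -
  obtain S T where ST: "ST = (S, T)" by fastforce
  with assms(2) have S: "S \<in> {1..n^2} \<times> {1..n} \<rightarrow>\<^sub>E {1..n}" and T: "T \<in> {1..n^2} \<times> {1..n} \<rightarrow>\<^sub>E {1..n}"
    by (auto simp: admissible_tables_def row_perm_tables_def)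
  have "inv_into ({1..n} \<times> {1..n}) b (b (S (i, j), T (i, j))) = (S (i, j), T (i, j))"
    if "i \<in> {1..n^2}" "j \<in> {1..n}" for i j
    using that PiE_mem[OF S, of "(i, j)"] PiE_mem[OF T, of "(i, j)"]
    by (intro inv_into_f_f bij_betw_imp_inj_on[OF b]) simp
  then show ?thesis
    using S T unfolding ST position_tables_def column_perms_def
    by (auto simp: fun_eq_iff restrict_def PiE_def extensional_def)
qed

text \<open>
  Bijectivity of the columns is built into the tuples, whose entries are permutations;
  bijectivity of the rows has to be imposed on the tuples as a condition.
\<close>

lemma bij_betw_column_perms:
  assumes b: "bij_betw b ({1..n} \<times> {1..n}) {1..n^2}"
  shows "bij_betw (column_perms n b) (admissible_tables n)
    {\<sigma> \<in> {1..n} \<rightarrow>\<^sub>E {p. p permutes {1..n^2}}. rows_bij n (position_tables n b \<sigma>)}"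
    (is "bij_betw _ _ ?G")
proof (rule bij_betw_byWitness[where f' = "position_tables n b"])
  let ?p = "inv_into ({1..n} \<times> {1..n}) b"
  have p: "bij_betw ?p {1..n^2} ({1..n} \<times> {1..n})"
    using b by (rule bij_betw_inv_into)
  note left = position_tables_column_perms[OF b]
  show "\<forall>ST\<in>admissible_tables n. position_tables n b (column_perms n b ST) = ST"
    using left by blast
  show "\<forall>\<sigma>\<in>?G. column_perms n b (position_tables n b \<sigma>) = \<sigma>"
  proof
    fix \<sigma> assume "\<sigma> \<in> ?G"
    then have \<sigma>: "\<sigma> \<in> {1..n} \<rightarrow>\<^sub>E {p. p permutes {1..n^2}}" by simp
    show "column_perms n b (position_tables n b \<sigma>) = \<sigma>"
    proof (rule extensionalityI)
      show "column_perms n b (position_tables n b \<sigma>) \<in> extensional {1..n}"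
        by (auto simp: column_perms_def position_tables_def)
      show "\<sigma> \<in> extensional {1..n}"
        using \<sigma> by (simp add: PiE_def)
    next
      fix j assume j: "j \<in> {1..n}"
      have \<sigma>j: "\<sigma> j permutes {1..n^2}" using PiE_mem[OF \<sigma> j] by simp
      have inv: "b (?p (\<sigma> j i)) = \<sigma> j i" if "i \<in> {1..n^2}" for i
        using that permutes_in_image[OF \<sigma>j, of i] bij_betw_inv_into_right[OF b] by simp
      have "column_perms n b (position_tables n b \<sigma>) j =
          restrict_id (\<lambda>i. b (fst (position_tables n b \<sigma>) (i, j), snd (position_tables n b \<sigma>) (i, j))) {1..n^2}"
        using j by (simp add: column_perms_def case_prod_beta)
      also have "\<dots> = \<sigma> j"
        using j inv by (intro permutes_eq_restrict_id[OF \<sigma>j, symmetric]) (simp add: position_tables_def)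
      finally show "column_perms n b (position_tables n b \<sigma>) j = \<sigma> j" .
    qed
  qed
  show "column_perms n b ` admissible_tables n \<subseteq> ?G"
  proof (rule image_subsetI)
    fix ST assume A: "ST \<in> admissible_tables n"
    obtain S T where ST: "ST = (S, T)" by fastforce
    have "bij_betw (\<lambda>i. b (S (i, j), T (i, j))) {1..n^2} {1..n^2}" if "j \<in> {1..n}" for j
      using A that bij_betw_trans[OF _ b, of "\<lambda>i. (S (i, j), T (i, j))" "{1..n^2}"]
      by (auto simp: ST admissible_tables_def o_def)
    then have "column_perms n b ST \<in> {1..n} \<rightarrow>\<^sub>E {p. p permutes {1..n^2}}"
      by (auto simp: ST column_perms_def intro!: permutes_restrict_id)
    moreover have "rows_bij n ST"
      using A by (auto simp: ST rows_bij_def admissible_tables_def row_perm_tables_def)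
    ultimately show "column_perms n b ST \<in> ?G"
      using left[OF A] by simp
  qed
  show "position_tables n b ` ?G \<subseteq> admissible_tables n"
  proof (rule image_subsetI)
    fix \<sigma> assume G: "\<sigma> \<in> ?G"
    obtain S T where ST: "position_tables n b \<sigma> = (S, T)" by fastforce
    from G have PE: "\<sigma> \<in> {1..n} \<rightarrow>\<^sub>E {p. p permutes {1..n^2}}" and rows: "rows_bij n (S, T)"
      by (simp_all add: ST)
    have \<sigma>j: "\<sigma> j permutes {1..n^2}" if "j \<in> {1..n}" for j
      using PiE_mem[OF PE that] by simp
    have eq: "(S (i, j), T (i, j)) = (?p \<circ> \<sigma> j) i" if "i \<in> {1..n^2}" "j \<in> {1..n}" for i j
      using ST that by (auto simp: position_tables_def)
    have cols: "bij_betw (\<lambda>i. (S (i, j), T (i, j))) {1..n^2} ({1..n} \<times> {1..n})"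
      if "j \<in> {1..n}" for j
      using bij_betw_trans[OF permutes_imp_bij[OF \<sigma>j[OF that]] p] eq[OF _ that]
      by (subst bij_betw_cong[where g = "?p \<circ> \<sigma> j"]) auto
    have "(S (i, j), T (i, j)) \<in> {1..n} \<times> {1..n}" if "i \<in> {1..n^2}" "j \<in> {1..n}" for i j
      using bij_betwE[OF cols[OF that(2)]] that(1) by blast
    moreover have "S \<in> extensional ({1..n^2} \<times> {1..n})" "T \<in> extensional ({1..n^2} \<times> {1..n})"
      using ST by (auto simp: position_tables_def)
    ultimately have "S \<in> {1..n^2} \<times> {1..n} \<rightarrow>\<^sub>E {1..n}" "T \<in> {1..n^2} \<times> {1..n} \<rightarrow>\<^sub>E {1..n}"
      by (auto simp: PiE_def)
    then show "position_tables n b \<sigma> \<in> admissible_tables n"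
      using rows cols unfolding ST
      by (auto simp: admissible_tables_def row_perm_tables_def rows_bij_def)
  qed
qed

text \<open>
  Each factor of the product over \<open>i\<close> reads the tensor at one row of a table. A tuple with a row
  that is not a pair of permutations contributes nothing, since that factor is zero; the remaining
  tuples are exactly the admissible tables.
\<close>

lemma P_invariant_table_sum:
  fixes w :: "(nat \<Rightarrow> nat) \<Rightarrow> (nat \<Rightarrow> nat) \<Rightarrow> int"
  assumes b: "bij_betw b ({1..n} \<times> {1..n}) {1..n^2}"
    and v: "\<And>s t. s \<in> {1..n} \<rightarrow> {1..n} \<Longrightarrow> t \<in> {1..n} \<rightarrow> {1..n} \<Longrightarrow>
      v (\<lambda>j\<in>{1..n}. b (s j, t j)) =
        a * (if bij_betw s {1..n} {1..n} \<and> bij_betw t {1..n} {1..n}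
          then of_int (w (restrict_id s {1..n}) (restrict_id t {1..n})) else 0)"
  shows "P_invariant n (n^2) v = a ^ (n^2) * of_int (\<Sum>(S, T)\<in>admissible_tables n.
    column_sign n b (S, T) * (\<Prod>i=1..n^2.
      w (restrict_id (\<lambda>j. S (i, j)) {1..n}) (restrict_id (\<lambda>j. T (i, j)) {1..n})))"
proof -
  let ?p = "inv_into ({1..n} \<times> {1..n}) b"
  let ?PE = "{1..n} \<rightarrow>\<^sub>E {p. p permutes {1..n^2}}"
  define G where "G = {\<sigma> \<in> ?PE. rows_bij n (position_tables n b \<sigma>)}"
  define h where "h = (\<lambda>\<sigma>. of_int (\<Prod>j=1..n. sign (\<sigma> j)) * (\<Prod>i=1..n^2. v (\<lambda>j\<in>{1..n}. \<sigma> j i)))"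
  define W where "W = (\<lambda>(S, T). \<Prod>i=1..n^2.
      w (restrict_id (\<lambda>j. S (i, j)) {1..n}) (restrict_id (\<lambda>j. T (i, j)) {1..n}))"
  have prod_v: "(\<Prod>i=1..n^2. v (\<lambda>j\<in>{1..n}. \<sigma> j i)) =
      a ^ (n^2) * (if rows_bij n ST then of_int (W ST) else 0)"
    if \<sigma>: "\<sigma> \<in> ?PE" and ST: "ST = position_tables n b \<sigma>" for \<sigma> ST
  proof -
    obtain S T where S_T: "ST = (S, T)" by fastforce
    have row: "v (\<lambda>j\<in>{1..n}. \<sigma> j i) =
      a * (if bij_betw (\<lambda>j. S (i, j)) {1..n} {1..n} \<and> bij_betw (\<lambda>j. T (i, j)) {1..n} {1..n}
        then of_int (w (restrict_id (\<lambda>j. S (i, j)) {1..n}) (restrict_id (\<lambda>j. T (i, j)) {1..n}))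
        else 0)" if i: "i \<in> {1..n^2}" for i
    proof -
      have mem: "\<sigma> j i \<in> {1..n^2}" if "j \<in> {1..n}" for j
        using PiE_mem[OF \<sigma> that] permutes_in_image[of "\<sigma> j" "{1..n^2}" i] i by simp
      have eq: "(S (i, j), T (i, j)) = ?p (\<sigma> j i)" if "j \<in> {1..n}" for j
        using ST i that by (simp add: S_T position_tables_def)
      have p_mem: "(S (i, j), T (i, j)) \<in> {1..n} \<times> {1..n}" if "j \<in> {1..n}" for j
        unfolding eq[OF that] using bij_betwE[OF bij_betw_inv_into[OF b]] mem[OF that] by blast
      have "(\<lambda>j\<in>{1..n}. \<sigma> j i) = (\<lambda>j\<in>{1..n}. b (S (i, j), T (i, j)))"
      proof (rule restrict_ext)
        fix j assume j: "j \<in> {1..n}"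
        show "\<sigma> j i = b (S (i, j), T (i, j))"
          unfolding eq[OF j] using bij_betw_inv_into_right[OF b mem[OF j]] by simp
      qed
      then show ?thesis
        using p_mem by (simp only:) (rule v, auto)
    qed
    have "(\<Prod>i=1..n^2. v (\<lambda>j\<in>{1..n}. \<sigma> j i)) = a ^ (n^2) * (\<Prod>i=1..n^2.
      if bij_betw (\<lambda>j. S (i, j)) {1..n} {1..n} \<and> bij_betw (\<lambda>j. T (i, j)) {1..n} {1..n}
        then of_int (w (restrict_id (\<lambda>j. S (i, j)) {1..n}) (restrict_id (\<lambda>j. T (i, j)) {1..n}))
        else 0)"
      by (simp only: row prod.distrib cong: prod.cong) simp
    also have "(\<Prod>i=1..n^2.
      if bij_betw (\<lambda>j. S (i, j)) {1..n} {1..n} \<and> bij_betw (\<lambda>j. T (i, j)) {1..n} {1..n}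
        then of_int (w (restrict_id (\<lambda>j. S (i, j)) {1..n}) (restrict_id (\<lambda>j. T (i, j)) {1..n}))
        else 0) = (if rows_bij n ST then of_int (W ST) else (0::complex))"
    proof (cases "rows_bij n ST")
      case True
      then have "\<And>i. i \<in> {1..n^2} \<Longrightarrow> bij_betw (\<lambda>j. S (i, j)) {1..n} {1..n} \<and>
          bij_betw (\<lambda>j. T (i, j)) {1..n} {1..n}"
        by (auto simp: S_T rows_bij_def)
      then show ?thesis
        using True by (simp add: S_T W_def)
    next
      case False
      then show ?thesis by (auto simp: S_T rows_bij_def intro!: prod_zero)
    qed
    finally show ?thesis .
  qed
  have "P_invariant n (n^2) v = (\<Sum>\<sigma>\<in>?PE. h \<sigma>)"
    by (simp add: P_invariant_def h_def)
  also have "\<dots> = (\<Sum>\<sigma>\<in>G. h \<sigma>)"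
  proof (rule sum.mono_neutral_right)
    show "finite ?PE"
      by (intro finite_PiE) (auto intro: finite_permutations)
    show "\<forall>\<sigma>\<in>?PE - G. h \<sigma> = 0"
      using prod_v[OF _ refl] by (auto simp: G_def h_def)
  qed (auto simp: G_def)
  also have "\<dots> = (\<Sum>ST\<in>admissible_tables n. h (column_perms n b ST))"
    using sum.reindex_bij_betw[OF bij_betw_column_perms[OF b], of h] by (simp add: G_def)
  also have "\<dots> = (\<Sum>ST\<in>admissible_tables n. a ^ (n^2) * of_int (column_sign n b ST * W ST))"
  proof (rule sum.cong[OF refl])
    fix ST assume A: "ST \<in> admissible_tables n"
    obtain S T where S_T: "ST = (S, T)" by fastforce
    have inG: "column_perms n b ST \<in> ?PE" "rows_bij n ST"
      using A bij_betwE[OF bij_betw_column_perms[OF b]]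
      by (auto simp: S_T rows_bij_def admissible_tables_def row_perm_tables_def)
    note round_trip = position_tables_column_perms[OF b A, symmetric]
    have "(\<Prod>j=1..n. sign (column_perms n b ST j)) = column_sign n b ST"
      by (simp add: S_T column_perms_def column_sign_def)
    then show "h (column_perms n b ST) = a ^ (n^2) * of_int (column_sign n b ST * W ST)"
      using prod_v[OF inG(1) round_trip] inG(2) by (simp only: h_def of_int_mult if_True mult_ac)
  qed
  finally show ?thesis
    by (simp add: W_def sum_distrib_left case_prod_beta)
qed

section \<open>Signs\<close>

text \<open>
  The change of ordering \<open>\<tau> = b \<circ> c\<inverse>\<close> is composed with each of the \<open>n\<close> columns, which gives the
  factor \<open>sgn(\<tau>)^n = 1\<close>.
\<close>

lemma column_sign_ordering_independent:
  assumes n: "even n"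
    and b: "bij_betw b ({1..n} \<times> {1..n}) {1..n^2}"
    and c: "bij_betw c ({1..n} \<times> {1..n}) {1..n^2}"
    and ST: "ST \<in> admissible_tables n"
  shows "column_sign n b ST = column_sign n c ST"
proof -
  let ?K = "{1..n^2}"
  obtain S T where S_T: "ST = (S, T)" by fastforce
  define \<tau> where "\<tau> = restrict_id (b \<circ> inv_into ({1..n} \<times> {1..n}) c) ?K"
  have \<tau>: "\<tau> permutes ?K"
    unfolding \<tau>_def by (intro permutes_restrict_id bij_betw_trans[OF bij_betw_inv_into[OF c] b])
  have "sign (restrict_id (\<lambda>i. b (S (i, j), T (i, j))) ?K) =
      sign \<tau> * sign (restrict_id (\<lambda>i. c (S (i, j), T (i, j))) ?K)" if "j \<in> {1..n}" for j
  proof -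
    have col: "bij_betw (\<lambda>i. (S (i, j), T (i, j))) ?K ({1..n} \<times> {1..n})"
      using ST that by (auto simp: S_T admissible_tables_def)
    have bij: "bij_betw (\<lambda>i. d (S (i, j), T (i, j))) ?K ?K"
      if "bij_betw d ({1..n} \<times> {1..n}) ?K" for d
      using bij_betw_trans[OF col that] by (simp add: o_def)
    note perm = permutes_restrict_id[OF bij[OF c]]
    have "\<tau> (c (S (i, j), T (i, j))) = b (S (i, j), T (i, j))" if i: "i \<in> ?K" for i
    proof -
      have "inv_into ({1..n} \<times> {1..n}) c (c (S (i, j), T (i, j))) = (S (i, j), T (i, j))"
        using bij_betwE[OF col] i by (intro bij_betw_inv_into_left[OF c]) blast
      then show ?thesis
        using bij_betwE[OF bij[OF c]] i by (simp add: \<tau>_def)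
    qed
    then have "restrict_id (\<lambda>i. b (S (i, j), T (i, j))) ?K =
        \<tau> \<circ> restrict_id (\<lambda>i. c (S (i, j), T (i, j))) ?K"
      by (intro permutes_eq_restrict_id[symmetric] permutes_compose[OF perm \<tau>]) auto
    moreover have "permutation \<tau>" "permutation (restrict_id (\<lambda>i. c (S (i, j), T (i, j))) ?K)"
      using \<tau> perm permutation_permutes by blast+
    ultimately show ?thesis
      by (simp only: sign_compose)
  qed
  then have "column_sign n b ST = sign \<tau> ^ n * column_sign n c ST"
    by (simp add: S_T column_sign_def prod.distrib)
  also have "sign \<tau> ^ n = 1"
    using n by (cases \<tau> rule: sign_cases) auto
  finally show ?thesis by simp
qed

lemma prod_pm_one:
  fixes f :: "'a \<Rightarrow> int"
  assumes "\<And>x. x \<in> A \<Longrightarrow> f x = 1 \<or> f x = -1"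
  shows "prod f A = 1 \<or> prod f A = -1"
  using assms
proof (induction A rule: infinite_finite_induct)
  case (insert x F)
  have "f x = 1 \<or> f x = -1" "prod f F = 1 \<or> prod f F = -1"
    using insert.IH insert.prems by blast+
  then show ?case using insert.hyps by auto
qed auto

lemma sign_pm_one: "sign p = 1 \<or> sign p = -1"
  by (cases p rule: sign_cases) auto

lemma column_sign_pm_one: "column_sign n b ST = 1 \<or> column_sign n b ST = -1"
  unfolding column_sign_def case_prod_beta by (intro prod_pm_one sign_pm_one)

lemma table_sign_pm_one: "table_sign n b ST = 1 \<or> table_sign n b ST = -1"
proof -
  have "row_sign1 n S = 1 \<or> row_sign1 n S = -1" for S
    unfolding row_sign1_def by (intro prod_pm_one sign_pm_one)
  from this[of "fst ST"] this[of "snd ST"] column_sign_pm_one[of n b ST] show ?thesis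
    unfolding table_sign_def row_sign_def case_prod_beta by auto
qed

lemma sum_pm_one_eq_card_diff:
  fixes f :: "'a \<Rightarrow> int"
  assumes "finite A" and pm: "\<And>x. f x = 1 \<or> f x = -1"
  shows "sum f A = int (card {x \<in> A. f x = 1}) - int (card {x \<in> A. f x \<noteq> 1})"
proof -
  have card: "int (card {x \<in> A. Q x}) = (\<Sum>x\<in>A. if Q x then 1 else 0)" for Q
    using assms(1) by (simp add: sum.inter_filter[symmetric])
  have "sum f A = (\<Sum>x\<in>A. (if f x = 1 then 1 else 0) - (if f x \<noteq> 1 then 1 else 0))"
  proof (intro sum.cong refl)
    fix x show "f x = (if f x = 1 then 1 else 0) - (if f x \<noteq> 1 then 1 else 0)"
      using pm[of x] by auto
  qed
  also have "\<dots> = int (card {x \<in> A. f x = 1}) - int (card {x \<in> A. f x \<noteq> 1})"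
    by (simp only: sum_subtractf card)
  finally show ?thesis .
qed

lemma finite_admissible_tables: "finite (admissible_tables n)"
proof -
  have "finite (row_perm_tables n)"
    unfolding row_perm_tables_def by (intro finite_Collect_conjI disjI1) (simp add: finite_PiE)
  then have "finite (row_perm_tables n \<times> row_perm_tables n)"
    by simp
  then show ?thesis
    by (rule rev_finite_subset) (auto simp: admissible_tables_def)
qed

section \<open>Evaluation of the invariant\<close>

theorem proposition3p28:
  fixes n :: nat and b c :: "nat \<times> nat \<Rightarrow> nat"
  assumes "n \<ge> 1" and "even n"
    and "bij_betw b ({1..n} \<times> {1..n}) {1..n^2}"
    and "bij_betw c ({1..n} \<times> {1..n}) {1..n^2}"
  shows "P_invariant n (n^2) (sym_tensor n (det_form n b)) =
      of_int (int (card (even_tables n c)) - int (card (odd_tables n c))) / fact n ^ (n^2) \<and>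
    P_invariant n (n^2) (sym_tensor n (per_form n b)) =
      of_int (int (card (column_even_tables n c)) - int (card (column_odd_tables n c))) / fact n ^ (n^2)"
proof
  note b = assms(3)
  note inj = bij_betw_imp_inj_on[OF b]
  note indep = column_sign_ordering_independent[OF assms(2,3,4)]
  let ?r = "\<lambda>S i. restrict_id (\<lambda>j. S (i, j)) {1..n}"
  have "sign (restrict_id s {1..n} \<circ> inv (restrict_id t {1..n})) =
      sign (restrict_id s {1..n}) * sign (restrict_id t {1..n})"
    if "bij_betw s {1..n} {1..n}" "bij_betw t {1..n} {1..n}" for s t :: "nat \<Rightarrow> nat"
  proof -
    have "permutation (restrict_id s {1..n})" "permutation (restrict_id t {1..n})"
      using that permutes_restrict_id permutation_permutes by blast+
    then show ?thesis
      by (simp add: sign_compose sign_inverse permutation_inverse)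
  qed
  then have "P_invariant n (n^2) (sym_tensor n (det_form n b)) =
      (1 / fact n) ^ (n^2) * of_int (\<Sum>(S, T)\<in>admissible_tables n.
        column_sign n b (S, T) * (\<Prod>i=1..n^2. sign (?r S i) * sign (?r T i)))"
    unfolding det_form_def
    by (intro P_invariant_table_sum[OF b, where w = "\<lambda>p q. sign p * sign q"])
       (simp add: sym_tensor_immanant[OF inj])
  also have "(\<Sum>(S, T)\<in>admissible_tables n.
        column_sign n b (S, T) * (\<Prod>i=1..n^2. sign (?r S i) * sign (?r T i))) =
      (\<Sum>ST\<in>admissible_tables n. table_sign n c ST)"
    using indep by (intro sum.cong)
      (auto simp: table_sign_def row_sign_def row_sign1_def prod.distrib)
  also have "\<dots> = int (card (even_tables n c)) - int (card (odd_tables n c))"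
    unfolding even_tables_def odd_tables_def
    by (intro sum_pm_one_eq_card_diff finite_admissible_tables table_sign_pm_one)
  finally show "P_invariant n (n^2) (sym_tensor n (det_form n b)) =
      of_int (int (card (even_tables n c)) - int (card (odd_tables n c))) / fact n ^ (n^2)"
    by (simp add: power_one_over)

  (* The coefficient 1 has to be visible for the form to match the general immanant. *)
  have "per_form n b = (\<Sum>\<pi> | \<pi> permutes {1..n}. of_int 1 * (\<Prod>j=1..n. var (b (\<pi> j, j))))"
    by (simp add: per_form_def)
  then have "P_invariant n (n^2) (sym_tensor n (per_form n b)) =
      (1 / fact n) ^ (n^2) * of_int (\<Sum>(S, T)\<in>admissible_tables n.
        column_sign n b (S, T) * (\<Prod>i=1..n^2. 1))"
    by (simp only:) (intro P_invariant_table_sum[OF b, where w = "\<lambda>p q. 1"]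
        sym_tensor_immanant[OF inj, where w = "\<lambda>_. 1"])
  also have "(\<Sum>(S, T)\<in>admissible_tables n. column_sign n b (S, T) * (\<Prod>i=1..n^2. 1)) =
      (\<Sum>ST\<in>admissible_tables n. column_sign n c ST)"
    using indep by (intro sum.cong) auto
  also have "\<dots> = int (card (column_even_tables n c)) - int (card (column_odd_tables n c))"
    unfolding column_even_tables_def column_odd_tables_def
    by (intro sum_pm_one_eq_card_diff finite_admissible_tables column_sign_pm_one)
  finally show "P_invariant n (n^2) (sym_tensor n (per_form n b)) =
      of_int (int (card (column_even_tables n c)) - int (card (column_odd_tables n c))) / fact n ^ (n^2)"
    by (simp add: power_one_over)
qed

end
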